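(* Let $Q=(V_Q,E_Q)$ be a (finite, connected, directed) query graph, not necessarily acyclic, with treewidth $\mathrm{tw}(Q)$. Given a lifted graph with color set $C$ and color graph $F$, and a decomposable estimator $W$ on it, the lifted subgraph count $$\Phi(Q,F,W)=\sum_{\pi\in\hom(Q,F)}W(\pi)$$ can be computed in time $O\left(|C|^{\mathrm{tw}(Q)+1}\right)$, where the constant in the $O$-notation depends only on $Q$.
   Context: Lifted graph: a coloring $\sigma:V\to C$ of the vertices of a finite directed data graph $G=(V,E)$ by a finite nonempty set $C$ of colors determines a color graph $F=(C,E_F)$ with $E_F=\{(c_1,c_2): \text{some edge of }G\text{ goes from a vertex colored }c_1\text{ to a vertex colored }c_2\}$, together with color sizes $\psi(c)=|\sigma^{-1}(c)|$ and numerical edge statistics $\tau$ on pairs of colors. $\hom(Q,F)$ is the set of maps $\pi:V_Q\to C$ such that $(\pi(x),\pi(y))\in E_F$ for all $(x,y)\in E_Q$. Decomposable estimator: $W$ is decomposable if it is a product of one factor for the first query vertex and one factor per query edge, each edge factor depending only on the colors of the two endpoints of that edge: there are a vertex $x_1\in V_Q$ and functions $\omega_e:C\times C\to\mathbb R_{\ge0}$, $e\in E_Q$, with $$W(\pi)=\psi(\pi(x_1))\prod_{e=(x,y)\in E_Q}\omega_e(\pi(x),\pi(y)).$$ With $\omega_e(c,c')=0$ whenever $(c,c')\notin E_F$, the sum over $\hom(Q,F)$ equals the sum over all maps $V_Q\to C$. Cost model: the input consists of the tables of values of $\psi$ and of the $\omega_e$; time is the number of elementary steps, where a table lookup or store and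 a real addition or multiplication each cost one step. $\mathrm{tw}(Q)$ is the treewidth of the underlying undirected graph of $Q$. *)

theory Defs
  imports Complex_Main "HOL-Library.FuncSet" "Graph_Theory.Graph_Theory"
begin

section \<open>Treewidth\<close>

text \<open>
  The library predicate for trees excludes directed cycles only, and counts a pair of opposite
  arcs as a cycle.  Undirected trees are therefore defined here, as connected simple graphs
  (symmetric loop-free digraphs) without a cycle on at least three vertices.
\<close>

definition undirected_tree :: "'i pair_pre_digraph \<Rightarrow> bool" where
  "undirected_tree T \<longleftrightarrow>
     pair_graph T \<and> Digraph_Component.connected (with_proj T) \<and>
     \<not> (\<exists>p. vpath p (with_proj T) \<and> 3 \<le> length p \<and> (last p, hd p) \<in> parcs T)"

text \<open>
  Bags of the underlying undirected graph: orientation, antiparallel arcs and loops of \<open>Q\<close> do not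
  matter.  Natural numbers suffice as nodes of the (finite) tree.
\<close>

definition tree_decomposition ::
    "'q pair_pre_digraph \<Rightarrow> nat pair_pre_digraph \<Rightarrow> (nat \<Rightarrow> 'q set) \<Rightarrow> bool" where
  "tree_decomposition Q T B \<longleftrightarrow>
     undirected_tree T \<and>
     (\<forall>i\<in>pverts T. B i \<subseteq> pverts Q) \<and>
     (\<forall>x\<in>pverts Q. \<exists>i\<in>pverts T. x \<in> B i) \<and>
     (\<forall>(x, y)\<in>parcs Q. \<exists>i\<in>pverts T. x \<in> B i \<and> y \<in> B i) \<and>
     (\<forall>x\<in>pverts Q.
        Digraph_Component.connected (with_proj T \<restriction> {i \<in> pverts T. x \<in> B i}))"

text \<open>The subtraction does not truncate when \<open>Q\<close> has a vertex.\<close>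

definition decomposition_width :: "nat pair_pre_digraph \<Rightarrow> (nat \<Rightarrow> 'q set) \<Rightarrow> nat" where
  "decomposition_width T B = Max ((\<lambda>i. card (B i)) ` pverts T) - 1"

definition treewidth :: "'q pair_pre_digraph \<Rightarrow> nat" where
  "treewidth Q = (LEAST k. \<exists>T B. tree_decomposition Q T B \<and> decomposition_width T B = k)"


section \<open>Lifted graphs and lifted subgraph counts\<close>

locale lifted_graph = pair_fin_digraph G
  for G :: "'v pair_pre_digraph" and C :: "'c set" and \<sigma> :: "'v \<Rightarrow> 'c" +
  assumes finite_colors: "finite C"
    and colors_nonempty: "C \<noteq> {}"
    and coloring: "\<sigma> \<in> pverts G \<rightarrow> C"

definition color_graph ::
    "'v pair_pre_digraph \<Rightarrow> 'c set \<Rightarrow> ('v \<Rightarrow> 'c) \<Rightarrow> 'c pair_pre_digraph" where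
  "color_graph G C \<sigma> = \<lparr> pverts = C, parcs = {(\<sigma> u, \<sigma> v) | u v. (u, v) \<in> parcs G} \<rparr>"

definition color_size :: "'v pair_pre_digraph \<Rightarrow> ('v \<Rightarrow> 'c) \<Rightarrow> 'c \<Rightarrow> nat" where
  "color_size G \<sigma> c = card {v \<in> pverts G. \<sigma> v = c}"

definition homs :: "'q pair_pre_digraph \<Rightarrow> 'c pair_pre_digraph \<Rightarrow> ('q \<Rightarrow> 'c) set" where
  "homs Q F =
     {\<pi> \<in> pverts Q \<rightarrow>\<^sub>E pverts F. \<forall>(x, y)\<in>parcs Q. (\<pi> x, \<pi> y) \<in> parcs F}"

definition lifted_count ::
    "'q pair_pre_digraph \<Rightarrow> 'c pair_pre_digraph \<Rightarrow> (('q \<Rightarrow> 'c) \<Rightarrow> real) \<Rightarrow> real" where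
  "lifted_count Q F W = (\<Sum>\<pi>\<in>homs Q F. W \<pi>)"

text \<open>
  \<open>W\<close> is decomposable if this holds for some \<open>x1\<close> and \<open>\<omega>\<close>.  Any numerical edge statistics
  of the lifted graph enter only through the values of the edge factors \<open>\<omega>\<close>, which are
  extended by zero to the pairs of colors that are not arcs of \<open>F\<close>.
\<close>

definition decomposes ::
    "'q pair_pre_digraph \<Rightarrow> 'c pair_pre_digraph \<Rightarrow> ('c \<Rightarrow> nat) \<Rightarrow> (('q \<Rightarrow> 'c) \<Rightarrow> real)
      \<Rightarrow> 'q \<Rightarrow> ('q \<times> 'q \<Rightarrow> 'c \<Rightarrow> 'c \<Rightarrow> real) \<Rightarrow> bool" where
  "decomposes Q F \<psi> W x1 \<omega> \<longleftrightarrow>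
     x1 \<in> pverts Q \<and>
     (\<forall>e\<in>parcs Q. \<forall>c\<in>pverts F. \<forall>c'\<in>pverts F.
        0 \<le> \<omega> e c c' \<and> ((c, c') \<notin> parcs F \<longrightarrow> \<omega> e c c' = 0)) \<and>
     (\<forall>\<pi>\<in>homs Q F.
        W \<pi> = real (\<psi> (\<pi> x1)) * (\<Prod>(x, y)\<in>parcs Q. \<omega> (x, y) (\<pi> x) (\<pi> y)))"


section \<open>Cost model\<close>

text \<open>
  Programs are uniform in the set of colors: they mention tables, numbered registers for reals and
  numbered registers for colors, but no particular color.  A table entry is addressed by a tuple
  of color registers.  The input tables are \<open>Psi\<close> and one table \<open>Omega e\<close> per query edge;
  \<open>Work k\<close> are tables for intermediate results.  The only control structures are sequencing and a
  loop over all colors, so this is a restricted fragment of a real-number random access machine.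
\<close>

datatype 'q table = Psi | Omega "'q \<times> 'q" | Work nat

datatype 'q com =
    Zero nat
  | One nat
  | Load nat "'q table" "nat list"
  | Store "'q table" "nat list" nat
  | Add nat nat nat
  | Mul nat nat nat
  | Seq "'q com" "'q com"
  | For nat "'q com"

record ('q, 'c) state =
  color_reg :: "nat \<Rightarrow> 'c"
  real_reg :: "nat \<Rightarrow> real"
  memory :: "'q table \<Rightarrow> 'c list \<Rightarrow> real"

text \<open>
  The list \<open>cs\<close> enumerates the set of colors.  The result is the final state and the number of steps:
  one for each basic instruction, and for a loop one for its initialisation and one per iteration
  in addition to the cost of the body.
\<close>

primrec exec :: "'c list \<Rightarrow> 'q com \<Rightarrow> ('q, 'c) state \<Rightarrow> ('q, 'c) state \<times> nat" where
  "exec cs (Zero r) s = (s\<lparr>real_reg := (real_reg s)(r := 0)\<rparr>, 1)"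
| "exec cs (One r) s = (s\<lparr>real_reg := (real_reg s)(r := 1)\<rparr>, 1)"
| "exec cs (Load r t is) s =
     (s\<lparr>real_reg := (real_reg s)(r := memory s t (map (color_reg s) is))\<rparr>, 1)"
| "exec cs (Store t is r) s =
     (s\<lparr>memory := (memory s)(t := (memory s t)(map (color_reg s) is := real_reg s r))\<rparr>, 1)"
| "exec cs (Add r a b) s =
     (s\<lparr>real_reg := (real_reg s)(r := real_reg s a + real_reg s b)\<rparr>, 1)"
| "exec cs (Mul r a b) s =
     (s\<lparr>real_reg := (real_reg s)(r := real_reg s a * real_reg s b)\<rparr>, 1)"
| "exec cs (Seq p q) s =
     (let (s1, t1) = exec cs p s; (s2, t2) = exec cs q s1 in (s2, t1 + t2))"
| "exec cs (For i p) s =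
     fold (\<lambda>c (s, t). let (s', t') = exec cs p (s\<lparr>color_reg := (color_reg s)(i := c)\<rparr>)
                      in (s', t + t' + 1)) cs (s, 1)"

text \<open>All registers, all work tables and all entries not listed here are arbitrary initially.\<close>

definition input_loaded ::
    "'q pair_pre_digraph \<Rightarrow> 'c set \<Rightarrow> ('c \<Rightarrow> nat) \<Rightarrow> ('q \<times> 'q \<Rightarrow> 'c \<Rightarrow> 'c \<Rightarrow> real)
      \<Rightarrow> ('q, 'c) state \<Rightarrow> bool" where
  "input_loaded Q C \<psi> \<omega> s \<longleftrightarrow>
     (\<forall>c\<in>C. memory s Psi [c] = real (\<psi> c)) \<and>
     (\<forall>e\<in>parcs Q. \<forall>c\<in>C. \<forall>c'\<in>C. memory s (Omega e) [c, c'] = \<omega> e c c')"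

text \<open>The result is returned in real register \<open>0\<close>.\<close>

definition computes_within ::
    "'c list \<Rightarrow> 'q com \<Rightarrow> ('q, 'c) state \<Rightarrow> real \<Rightarrow> nat \<Rightarrow> bool" where
  "computes_within cs p s y n \<longleftrightarrow>
     (let (s', t) = exec cs p s in real_reg s' 0 = y \<and> t \<le> n)"

end

theory Submission
  imports Defs
begin

text \<open>
  The sum over all maps is computed by variable elimination: to sum out a query vertex \<open>v\<close>, the
  factors that mention \<open>v\<close> are replaced by one new table indexed by their other vertices.  If there
  are at most \<open>w\<close> of these, filling the table takes time \<open>O(|C| ^ (w + 1))\<close>.  A tree decomposition of
  width \<open>w\<close> yields a suitable elimination order: a vertex that occurs only in the bag of a leaf
  shares factors only with the other vertices of that bag, and a leaf without such a vertex can be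
  dropped from the tree because its bag is contained in that of its neighbour.  Extending the edge
  factors by zero makes the sum over homomorphisms a sum over all maps.
\<close>

section \<open>Elimination orders from tree decompositions\<close>

text \<open>Connectivity of the part of \<open>R\<close> induced by \<open>S\<close>, since
  \<open>rtrancl_on\<close> keeps walks inside \<open>S\<close>. Shrinking the node set leaves
  \<open>R\<close> untouched, and in contrast to \<open>connected\<close> the empty set qualifies,
  as is needed once a query vertex has left every bag.\<close>

definition linked :: "'i rel \<Rightarrow> 'i set \<Rightarrow> bool" where
  "linked R S \<longleftrightarrow> (\<forall>x\<in>S. \<forall>y\<in>S. (x, y) \<in> rtrancl_on S R)"

definition cycle_free :: "'i rel \<Rightarrow> 'i set \<Rightarrow> bool" where
  "cycle_free R N \<longleftrightarrow>
     \<not> (\<exists>p. distinct p \<and> set p \<subseteq> N \<and> set (vwalk_arcs p) \<subseteq> R \<and> 3 \<le> length p \<and> (last p, hd p) \<in> R)"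

lemma cycle_free_subset: "cycle_free R N \<Longrightarrow> M \<subseteq> N \<Longrightarrow> cycle_free R M"
  unfolding cycle_free_def by blast

lemma set_vwalk_arcs_take: "set (vwalk_arcs (take n p)) \<subseteq> set (vwalk_arcs p)"
proof (induction p arbitrary: n rule: vwalk_arcs.induct)
  case (2 x)
  then show ?case by (cases n) auto
next
  case (3 x y xs)
  then show ?case
  proof (cases n)
    case (Suc m)
    show ?thesis
    proof (cases m)
      case Suc': (Suc l)
      show ?thesis using "3.IH"[of m] unfolding Suc Suc' by auto
    qed (simp add: Suc)
  qed simp
qed simp

text \<open>An end of a longest path is a leaf.\<close>

lemma cycle_free_has_leaf:
  assumes fin: "finite N" and ne: "N \<noteq> {}" and sym: "sym R" and irr: "irrefl R"
    and cf: "cycle_free R N"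
  obtains i j where "i \<in> N" "\<And>k. k \<in> N \<Longrightarrow> (i, k) \<in> R \<Longrightarrow> k = j"
proof -
  define P where "P p \<longleftrightarrow> distinct p \<and> set p \<subseteq> N \<and> set (vwalk_arcs p) \<subseteq> R \<and> p \<noteq> []" for p
  obtain a where "a \<in> N" using ne by blast
  then have "P [a]" by (simp add: P_def)
  \<comment> \<open>A path has at most \<open>card N\<close> nodes, so a longest one exists.\<close>
  moreover have "\<forall>q. P q \<longrightarrow> length q < Suc (card N)"
  proof (intro allI impI)
    fix q assume "P q"
    then show "length q < Suc (card N)"
      using card_mono[OF fin, of "set q"] distinct_card[of q] by (simp add: P_def)
  qed
  ultimately have "\<exists>p. P p \<and> (\<forall>q. P q \<longrightarrow> length q \<le> length p)"
    using ex_has_greatest_nat[of P "[a]" length "Suc (card N)"] by blast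
  then obtain p where p: "P p" and max: "\<And>q. P q \<Longrightarrow> length q \<le> length p" by blast
  from p obtain i q where pq: "p = i # q" by (cases p) (auto simp: P_def)
  \<comment> \<open>Off the path \<open>k\<close> would extend it, at position 0 it would give a
    loop, and from position 2 on it would close a cycle; so the second node of the path serves as
    \<open>j\<close>. If the path is \<open>[i]\<close> alone, there is no such \<open>k\<close> and
    the value of \<open>p ! 1\<close> is immaterial.\<close>
  have "k = p ! 1" if k: "k \<in> N" "(i, k) \<in> R" for k
  proof -
    have "k \<in> set p"
    proof (rule ccontr)
      assume "k \<notin> set p"
      then have "P (k # p)" using p k symD[OF sym k(2)] by (auto simp: P_def pq)
      then show False using max[of "k # p"] by simp
    qed
    then obtain m where m: "m < length p" "k = p ! m" by (metis in_set_conv_nth)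
    have "m \<noteq> 0"
    proof
      assume "m = 0"
      then show False using k(2) irr m by (simp add: pq irrefl_def)
    qed
    moreover have "\<not> 2 \<le> m"
    proof
      assume "2 \<le> m"
      let ?c = "take (Suc m) p"
      have "last ?c = k" "hd ?c = i" using m by (auto simp: last_conv_nth pq)
      then have "(last ?c, hd ?c) \<in> R" using symD[OF sym k(2)] by simp
      moreover have "distinct ?c" "set ?c \<subseteq> N" "set (vwalk_arcs ?c) \<subseteq> R"
        using p set_vwalk_arcs_take[of "Suc m" p] set_take_subset[of "Suc m" p]
        unfolding P_def by (meson distinct_take subset_trans)+
      moreover have "3 \<le> length ?c" using m \<open>2 \<le> m\<close> by simp
      ultimately show False using cf unfolding cycle_free_def by blast
    qed
    ultimately show ?thesis using m(2) by (metis One_nat_def less_2_cases not_le)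
  qed
  moreover have "i \<in> N" using p by (simp add: P_def pq)
  ultimately show thesis using that by blast
qed

lemma linked_empty: "linked R {}"
  by (simp add: linked_def)

text \<open>A walk that passes through \<open>i\<close> enters and leaves it by the same node
  \<open>j\<close>, so the detour can be cut out.\<close>

lemma linked_remove_leaf:
  assumes link: "linked R S" and irr: "irrefl R" and sym: "sym R"
    and leaf: "\<And>k. k \<in> S \<Longrightarrow> (i, k) \<in> R \<Longrightarrow> k = j"
  shows "linked R (S - {i})"
  unfolding linked_def
proof (intro ballI)
  fix x y assume x: "x \<in> S - {i}" and y: "y \<in> S - {i}"
  \<comment> \<open>The invariant also covers a walk that currently stands at \<open>i\<close>:
    every neighbour of \<open>i\<close> has then been reached without using \<open>i\<close>, in
    particular the one at which the walk continues.\<close>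
  have "(x, z) \<in> rtrancl_on (S - {i}) R \<or>
      z = i \<and> (\<forall>k\<in>S. (k, i) \<in> R \<longrightarrow> (x, k) \<in> rtrancl_on (S - {i}) R)"
    if "(x, z) \<in> rtrancl_on S R" for z
    using that
  proof (induction rule: rtrancl_on_induct)
    case base
    then show ?case using x by auto
  next
    case (step z z')
    have uniq: "k = j" if "k \<in> S" "(k, i) \<in> R" for k
      using leaf[OF that(1)] symD[OF sym that(2)] by blast
    show ?case
    proof (cases "z' = i")
      case True
      then have "z \<noteq> i" using step(2) irr by (auto simp: irrefl_def)
      then have "(x, z) \<in> rtrancl_on (S - {i}) R" using step by blast
      then show ?thesis using True uniq step by metis
    next
      case False
      show ?thesis
      proof (cases "z = i")
        case True
        have "(z', i) \<in> R" using symD[OF sym step(2)] True by simp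
        then show ?thesis
          using step True in_rtrancl_on_in_F(2)[of x i "S - {i}" R] by blast
      next
        case zi: False
        then have "(x, z) \<in> rtrancl_on (S - {i}) R" using step by blast
        then show ?thesis using step False by (auto intro: rtrancl_on_into_rtrancl_on)
      qed
    qed
  qed
  from this[of y] show "(x, y) \<in> rtrancl_on (S - {i}) R"
    using link x y by (auto simp: linked_def)
qed

lemma linked_neighbour:
  assumes "linked R S" "i \<in> S" "k \<in> S" "i \<noteq> k"
  obtains j where "j \<in> S" "(i, j) \<in> R"
proof -
  have "(i, k) \<in> rtrancl_on S R" using assms by (auto simp: linked_def)
  then show thesis using assms(4) that
    by (cases rule: converse_rtrancl_on_cases) (auto dest: in_rtrancl_on_in_F)
qed

text \<open>\<open>H\<close> consists of the scopes of the factors present before \<open>v\<close> is summed out.\<close>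

fun elim_width :: "nat \<Rightarrow> 'q list \<Rightarrow> 'q set set \<Rightarrow> bool" where
  "elim_width w [] H = True"
| "elim_width w (v # vs) H =
     (card (\<Union>{X\<in>H. v \<in> X} - {v}) \<le> w \<and>
      elim_width w vs (insert (\<Union>{X\<in>H. v \<in> X} - {v}) {X\<in>H. v \<notin> X}))"

text \<open>
  At a leaf of the decomposition tree, either the bag has a vertex that lies in no other bag and can
  be eliminated, or the bag is contained in the one at the neighbour and the leaf can be dropped.
\<close>

lemma elim_order_exists:
  assumes "finite N" "N \<noteq> {}" "sym R" "irrefl R" "cycle_free R N" "linked R N"
    and "\<And>i. i \<in> N \<Longrightarrow> finite (B i) \<and> card (B i) \<le> Suc w"
    and "\<And>x. linked R {i\<in>N. x \<in> B i}"
    and "\<And>X. X \<in> H \<Longrightarrow> \<exists>i\<in>N. X \<subseteq> B i"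
  shows "\<exists>vs. distinct vs \<and> set vs = (\<Union>i\<in>N. B i) \<and> elim_width w vs H"
  using assms
\<comment> \<open>Eliminating a vertex shrinks a bag and dropping a leaf removes a node, so the
  number of nodes plus the bag sizes decreases in either case.\<close>
proof (induction "card N + (\<Sum>i\<in>N. card (B i))" arbitrary: N B H rule: less_induct)
  case less
  obtain i j where i: "i \<in> N" and leaf: "\<And>k. k \<in> N \<Longrightarrow> (i, k) \<in> R \<Longrightarrow> k = j"
    using cycle_free_has_leaf less.prems(1-5) by metis
  show ?case
  proof (cases "\<exists>v\<in>B i. \<forall>k\<in>N - {i}. v \<notin> B k")
    case True
    then obtain v where v: "v \<in> B i" and priv: "\<And>k. k \<in> N \<Longrightarrow> v \<in> B k \<Longrightarrow> k = i" by blast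
    define B' where "B' = B(i := B i - {v})"
    define U where "U = \<Union>{X\<in>H. v \<in> X} - {v}"
    \<comment> \<open>No bag other than \<open>B i\<close> contains \<open>v\<close>, so every scope
      with \<open>v\<close> lies inside \<open>B i\<close>. Hence the new scope has at most
      \<open>w\<close> vertices.\<close>
    have U: "U \<subseteq> B i - {v}"
      using less.prems(9) priv unfolding U_def by blast
    have fin: "finite (B i)" and card: "card (B i) \<le> Suc w" using less.prems(7) i by auto
    have cardi: "card (B i - {v}) < card (B i)"
      using fin v by (rule card_Diff1_less)
    have le: "card (B' k) \<le> card (B k)" for k using cardi by (auto simp: B'_def)
    then have sum: "(\<Sum>k\<in>N. card (B' k)) < (\<Sum>k\<in>N. card (B k))"
      using i cardi less.prems(1) by (intro sum_strict_mono_ex1) (auto simp: B'_def)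
    have "\<exists>vs. distinct vs \<and> set vs = (\<Union>k\<in>N. B' k) \<and>
        elim_width w vs (insert U {X\<in>H. v \<notin> X})"
    proof (intro less.hyps)
      show "finite (B' k) \<and> card (B' k) \<le> Suc w" if "k \<in> N" for k
        using less.prems(7)[OF that] le[of k] by (auto simp: B'_def)
      show "linked R {k \<in> N. x \<in> B' k}" for x
      proof (cases "x = v")
        case True
        then have "{k \<in> N. x \<in> B' k} = {}" using priv by (auto simp: B'_def)
        then show ?thesis by (simp only: linked_empty)
      next
        case False
        then have "{k \<in> N. x \<in> B' k} = {k \<in> N. x \<in> B k}" by (auto simp: B'_def)
        then show ?thesis using less.prems(8) by simp
      qed
      \<comment> \<open>The shrunk bag at \<open>i\<close> holds the new scope; an old scope without
        \<open>v\<close> keeps its bag.\<close>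
      show "\<exists>k\<in>N. X \<subseteq> B' k" if "X \<in> insert U {X\<in>H. v \<notin> X}" for X
      proof (cases "X = U")
        case True
        then show ?thesis using U i by (auto simp: B'_def)
      next
        case False
        then obtain k where "k \<in> N" "X \<subseteq> B k" "v \<notin> X" using less.prems(9) \<open>X \<in> _\<close> by blast
        then show ?thesis by (intro bexI[of _ k]) (auto simp: B'_def)
      qed
    qed (use sum in simp, (fact less.prems)+)
    then obtain vs where vs: "distinct vs" "set vs = (\<Union>k\<in>N. B' k)"
      "elim_width w vs (insert U {X\<in>H. v \<notin> X})" by blast
    have "B' k = B k - {v}" if "k \<in> N" for k
      using priv[OF that] by (cases "k = i") (auto simp: B'_def)
    then have "(\<Union>k\<in>N. B' k) = (\<Union>k\<in>N. B k) - {v}" by simp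
    then have "(\<Union>k\<in>N. B k) = insert v (\<Union>k\<in>N. B' k)" "v \<notin> (\<Union>k\<in>N. B' k)"
      using i v by auto
    moreover have "card U \<le> w"
      using card_mono[OF _ U] fin card v by simp
    ultimately show ?thesis using vs by (intro exI[of _ "v # vs"]) (simp add: U_def)
  next
    case False
    show ?thesis
    proof (cases "N = {i}")
      case True
      \<comment> \<open>With no other node every vertex of \<open>B i\<close> would be private, so
        the bag is empty and nothing is left to eliminate.\<close>
      then have "B i = {}" using False by auto
      then show ?thesis using True by (intro exI[of _ "[]"]) simp
    next
      case ne: False
      then obtain k where "k \<in> N" "k \<noteq> i" using i by blast
      then obtain l where "l \<in> N" "(i, l) \<in> R"
        using linked_neighbour[OF less.prems(6) i, of k] by metis
      then have j: "j \<in> N" "(i, j) \<in> R" using leaf by auto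
      then have ji: "j \<noteq> i" using less.prems(4) by (auto simp: irrefl_def)
      \<comment> \<open>Each \<open>v\<close> in \<open>B i\<close> lies in another bag too. The
        nodes whose bags contain \<open>v\<close> are linked, so a walk among them leaves
        \<open>i\<close> through its only neighbour \<open>j\<close>.\<close>
      have sub: "B i \<subseteq> B j"
      proof
        fix v assume v: "v \<in> B i"
        then obtain k where "k \<in> N" "k \<noteq> i" "v \<in> B k" using False by blast
        then obtain l where "l \<in> N" "v \<in> B l" "(i, l) \<in> R"
          using linked_neighbour[OF less.prems(8)[of v], of i k] i v by auto
        then show "v \<in> B j" using leaf by auto
      qed
      have "\<exists>vs. distinct vs \<and> set vs = (\<Union>k\<in>N - {i}. B k) \<and> elim_width w vs H"
      proof (intro less.hyps)
        show "card (N - {i}) + (\<Sum>k\<in>N - {i}. card (B k)) < card N + (\<Sum>k\<in>N. card (B k))"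
          using less.prems(1) card_Diff1_less[OF less.prems(1) i]
          by (intro add_less_le_mono sum_mono2) auto
        show "linked R (N - {i})"
          by (rule linked_remove_leaf[OF less.prems(6,4,3) leaf])
        show "linked R {k \<in> N - {i}. x \<in> B k}" for x
        proof -
          have "{k \<in> N - {i}. x \<in> B k} = {k \<in> N. x \<in> B k} - {i}" by auto
          then show ?thesis
            using linked_remove_leaf[OF less.prems(8)[of x] less.prems(4,3), of i j] leaf by auto
        qed
        show "\<exists>k\<in>N - {i}. X \<subseteq> B k" if "X \<in> H" for X
          using less.prems(9)[OF that] sub j ji by blast
        show "cycle_free R (N - {i})" using less.prems(5) by (rule cycle_free_subset) auto
      qed (use less.prems(1-4,7) \<open>k \<in> N\<close> \<open>k \<noteq> i\<close> in auto)
      moreover have "(\<Union>k\<in>N - {i}. B k) = (\<Union>k\<in>N. B k)" using sub j ji by blast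
      ultimately show ?thesis by simp
    qed
  qed
qed

section \<open>Transfer to tree decompositions of digraphs\<close>

text \<open>\<open>connected\<close> speaks of the symmetric closure, which adds no arc when
  \<open>parcs T\<close> is symmetric; its walks are therefore walks along \<open>parcs T\<close>
  inside \<open>S\<close>. A strongly connected digraph has a vertex by definition.\<close>

lemma connected_imp_linked:
  assumes "Digraph_Component.connected (with_proj T \<restriction> S)" "sym (parcs T)"
  shows "S \<noteq> {}" "linked (parcs T) S"
proof -
  have sub: "parcs (mk_symmetric (with_proj T \<restriction> S)) \<subseteq> parcs T"
    using assms(2) by (auto simp: mk_symmetric_def dest: symD)
  have v: "pverts (mk_symmetric (with_proj T \<restriction> S)) = S" by (simp add: mk_symmetric_def)
  show "S \<noteq> {}" using assms(1) v
    by (simp add: Digraph_Component.connected_def strongly_connected_def)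
  have "(x, y) \<in> rtrancl_on S (parcs T)" if "x \<in> S" "y \<in> S" for x y
  proof -
    have "(x, y) \<in> rtrancl_on S (parcs (mk_symmetric (with_proj T \<restriction> S)))"
      using assms(1) that v
      by (simp add: Digraph_Component.connected_def strongly_connected_def reachable_def)
    then show ?thesis using rtrancl_on_mono[OF sub order_refl] by blast
  qed
  then show "linked (parcs T) S" by (simp add: linked_def)
qed

lemma decomposition_elim_order:
  assumes td: "tree_decomposition Q T B" and Q: "finite (pverts Q)"
    and H: "\<And>X. X \<in> H \<Longrightarrow> \<exists>i\<in>pverts T. X \<subseteq> B i"
  shows "\<exists>vs. distinct vs \<and> set vs = pverts Q \<and> elim_width (decomposition_width T B) vs H"
proof -
  interpret T: pair_graph T
    using td by (simp add: tree_decomposition_def undirected_tree_def)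
  have R: "sym (parcs T)" "irrefl (parcs T)"
    using T.pair_sym_arcs T.pair_no_loops by (force simp: symmetric_def irrefl_def)+
  have fin: "finite (pverts T)" by (rule T.pair_finite_verts)
  \<comment> \<open>\<open>T\<close> is its own restriction to all nodes, which brings connectedness
    of the whole tree into the form used for the bags.\<close>
  have sub: "with_proj T \<restriction> pverts T = with_proj T"
    by (auto simp: induce_subgraph_def with_proj_def T.in_arcsD1 T.in_arcsD2)
  have conn: "Digraph_Component.connected (with_proj T \<restriction> pverts T)"
    using td sub by (simp add: tree_decomposition_def undirected_tree_def)
  note whole = connected_imp_linked[OF conn R(1)]
  have "(\<Union>i\<in>pverts T. B i) = pverts Q"
    using td by (fastforce simp: tree_decomposition_def)
  moreover have "\<exists>vs. distinct vs \<and> set vs = (\<Union>i\<in>pverts T. B i) \<and>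
      elim_width (decomposition_width T B) vs H"
  proof (rule elim_order_exists[OF fin whole(1) R _ whole(2) _ _ H])
    show "cycle_free (parcs T) (pverts T)"
      unfolding cycle_free_def
    proof
      assume "\<exists>p. distinct p \<and> set p \<subseteq> pverts T \<and> set (vwalk_arcs p) \<subseteq> parcs T \<and>
        3 \<le> length p \<and> (last p, hd p) \<in> parcs T"
      then obtain p where p: "distinct p" "set p \<subseteq> pverts T" "set (vwalk_arcs p) \<subseteq> parcs T"
        "3 \<le> length p" "(last p, hd p) \<in> parcs T" by blast
      then have "vpath p (with_proj T)" by (auto simp: vpath_def vwalk_def)
      then show False using p td by (auto simp: tree_decomposition_def undirected_tree_def)
    qed
    show "finite (B i) \<and> card (B i) \<le> Suc (decomposition_width T B)" if "i \<in> pverts T" for i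
    proof
      show "finite (B i)" using td that Q by (auto simp: tree_decomposition_def intro: finite_subset)
      have "card (B i) \<le> Max ((\<lambda>i. card (B i)) ` pverts T)" using fin that by simp
      \<comment> \<open>Truncation does no harm: \<open>Suc (m - 1)\<close> is at least
        \<open>m\<close> even for \<open>m = 0\<close>.\<close>
      then show "card (B i) \<le> Suc (decomposition_width T B)" by (simp add: decomposition_width_def)
    qed
    show "linked (parcs T) {i \<in> pverts T. x \<in> B i}" for x
    proof (cases "x \<in> pverts Q")
      case True
      then show ?thesis
        using connected_imp_linked(2)[OF _ R(1)] td by (simp add: tree_decomposition_def)
    next
      case False
      then have "{i \<in> pverts T. x \<in> B i} = {}" using td by (auto simp: tree_decomposition_def)
      then show ?thesis by (simp only: linked_empty)
    qed
  qed
  ultimately show ?thesis by simp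
qed

text \<open>The one-node tree with all of \<open>pverts Q\<close> as its bag is a decomposition, so
  the \<open>LEAST\<close> ranges over a nonempty set of widths.\<close>

lemma treewidth_attained:
  assumes "pair_fin_digraph Q"
  obtains T B where "tree_decomposition Q T B" "decomposition_width T B = treewidth Q"
proof -
  interpret pair_fin_digraph Q by fact
  define T :: "nat pair_pre_digraph" where "T = \<lparr>pverts = {0}, parcs = {}\<rparr>"
  have "pair_graph T" by unfold_locales (auto simp: T_def symmetric_def sym_def)
  moreover have conn: "Digraph_Component.connected (with_proj T \<restriction> S)" if "S = {0}" for S
    using that by (auto simp: Digraph_Component.connected_def strongly_connected_def mk_symmetric_def
      T_def reachable_def)
  have "with_proj T \<restriction> {0} = with_proj T"
    by (auto simp: induce_subgraph_def with_proj_def T_def)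
  with conn[of "{0}"] have "Digraph_Component.connected (with_proj T)" by simp
  ultimately have "undirected_tree T" by (simp add: undirected_tree_def T_def)
  then have "tree_decomposition Q T (\<lambda>_. pverts Q)"
    using conn by (auto simp: tree_decomposition_def T_def in_arcsD1 in_arcsD2)
  then have "\<exists>k T B. tree_decomposition Q T B \<and> decomposition_width T B = k" by blast
  from LeastI_ex[OF this] show thesis using that unfolding treewidth_def by blast
qed

section \<open>Execution\<close>

abbreviation run :: "'c list \<Rightarrow> 'q com \<Rightarrow> ('q, 'c) state \<Rightarrow> ('q, 'c) state" where
  "run cs p s \<equiv> fst (exec cs p s)"

text \<open>No instruction branches on data, so the cost is a function of the program and the number
  \<open>n\<close> of colors alone. This separates running times from the semantics.\<close>

primrec steps :: "nat \<Rightarrow> 'q com \<Rightarrow> nat" where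
  "steps n (Zero r) = 1"
| "steps n (One r) = 1"
| "steps n (Load r t is) = 1"
| "steps n (Store t is r) = 1"
| "steps n (Add r a b) = 1"
| "steps n (Mul r a b) = 1"
| "steps n (Seq p q) = steps n p + steps n q"
| "steps n (For i p) = 1 + n * (steps n p + 1)"

text \<open>\<open>ds\<close> is kept apart from \<open>cs\<close>: the induction consumes the list
  of rounds, while loops inside the body still run over all colors.\<close>

lemma exec_For_fold:
  assumes "\<And>s. snd (exec cs p s) = k"
  shows "fold (\<lambda>c (s, t). let (s', t') = exec cs p (s\<lparr>color_reg := (color_reg s)(i := c)\<rparr>)
             in (s', t + t' + 1)) ds (s, t) =
    (fold (\<lambda>c s. run cs p (s\<lparr>color_reg := (color_reg s)(i := c)\<rparr>)) ds s, t + length ds * (k + 1))"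
  using assms by (induction ds arbitrary: s t) (auto simp: case_prod_unfold Let_def)

lemma snd_exec: "snd (exec cs p s) = steps (length cs) p"
proof (induction p arbitrary: s)
  case (For i p)
  show ?case using exec_For_fold[OF For] by simp
qed (auto simp: case_prod_unfold Let_def)

lemma run_Seq: "run cs (Seq p q) s = run cs q (run cs p s)"
  by (simp add: case_prod_unfold Let_def)

lemma run_For:
  "run cs (For i p) s = fold (\<lambda>c s. run cs p (s\<lparr>color_reg := (color_reg s)(i := c)\<rparr>)) cs s"
  by (simp only: exec.simps exec_For_fold[OF snd_exec] fst_conv)

declare exec.simps(7,8) [simp del]
declare run_Seq [simp]

definition loops :: "nat list \<Rightarrow> 'q com \<Rightarrow> 'q com" where
  "loops is p = foldr For is p"

text \<open>Besides its body a loop with \<open>n\<close> rounds costs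
  \<open>1 + n \<le> 2 * n\<close> steps. Together with the loops around it, each level of the nest
  thus adds at most \<open>2 * n ^ length is\<close>, whence the summand
  \<open>2 * length is\<close>.\<close>

lemma steps_loops_le:
  assumes "1 \<le> n"
  shows "steps n (loops is p) \<le> n ^ length is * (steps n p + 2 * length is)"
proof (induction "is")
  case (Cons i "is")
  let ?x = "n ^ length is * (steps n p + 2 * length is)"
  have "steps n (loops (i # is) p) \<le> 1 + n * (?x + 1)"
    using Cons by (simp add: loops_def)
  also have "\<dots> \<le> n * ?x + 2 * n" using assms by simp
  also have "\<dots> \<le> n * ?x + 2 * (n * n ^ length is)" using assms by simp
  finally show ?case by (simp add: algebra_simps)
qed (simp add: loops_def)

section \<open>Variable elimination\<close>

text \<open>A table with its scope, the query vertices whose colors form the address, in this order.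
  A loop of \<open>Q\<close> at \<open>x\<close> gives the scope \<open>[x, x]\<close>.\<close>

type_synonym 'q factor = "'q table \<times> 'q list"

definition weight :: "('q table \<Rightarrow> 'c list \<Rightarrow> real) \<Rightarrow> 'q factor list \<Rightarrow> ('q \<Rightarrow> 'c) \<Rightarrow> real" where
  "weight m fs \<pi> = (\<Prod>(t, xs)\<leftarrow>fs. m t (map \<pi> xs))"

lemma weight_cong:
  assumes "\<And>f. f \<in> set fs \<Longrightarrow> m (fst f) = m' (fst f)"
    and "\<And>f x. f \<in> set fs \<Longrightarrow> x \<in> set (snd f) \<Longrightarrow> \<pi> x = \<pi>' x"
  shows "weight m fs \<pi> = weight m' fs \<pi>'"
proof -
  have "map (\<lambda>(t, xs). m t (map \<pi> xs)) fs = map (\<lambda>(t, xs). m' t (map \<pi>' xs)) fs"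
    using assms by (intro map_cong) (auto simp: case_prod_unfold cong: map_cong)
  then show ?thesis by (simp only: weight_def)
qed

text \<open>\<open>idx\<close> gives the color register of a query vertex. Real register 3 holds the
  entry just loaded; throughout, 2 holds products under a sum, 1 the sum itself and 0 the final
  result.\<close>

primrec multiply :: "('q \<Rightarrow> nat) \<Rightarrow> nat \<Rightarrow> 'q factor list \<Rightarrow> 'q com" where
  "multiply idx r [] = One r"
| "multiply idx r (f # fs) =
     Seq (multiply idx r fs) (Seq (Load 3 (fst f) (map idx (snd f))) (Mul r r 3))"

lemma run_multiply:
  assumes "r \<noteq> 3"
  shows "color_reg (run cs (multiply idx r fs) s) = color_reg s"
    and "memory (run cs (multiply idx r fs) s) = memory s"
    and "real_reg (run cs (multiply idx r fs) s) r = weight (memory s) fs (color_reg s \<circ> idx)"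
    and "r' \<noteq> r \<Longrightarrow> r' \<noteq> 3 \<Longrightarrow> real_reg (run cs (multiply idx r fs) s) r' = real_reg s r'"
  using assms
  by (induction fs) (auto simp: weight_def case_prod_unfold mult.commute)

definition sum_out :: "('q \<Rightarrow> nat) \<Rightarrow> 'q \<Rightarrow> 'q factor list \<Rightarrow> 'q com" where
  "sum_out idx v fs = Seq (Zero 1) (For (idx v) (Seq (multiply idx 2 fs) (Add 1 1 2)))"

text \<open>\<open>idx\<close> keeps the register of \<open>v\<close> apart from those of the other
  vertices in the scopes, so writing to it changes the assignment at \<open>v\<close> only. The
  start value of real register 1 is kept general for the induction on \<open>ds\<close>.\<close>

lemma fold_sum_out:
  fixes cs ds :: "'c list" and fs :: "'q factor list" and v :: 'q
  assumes idx: "\<forall>f\<in>set fs. \<forall>x\<in>set (snd f). idx x = idx v \<longrightarrow> x = v"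
  defines "step \<equiv> \<lambda>c s. run cs (Seq (multiply idx 2 fs) (Add 1 1 2))
                          (s\<lparr>color_reg := (color_reg s)(idx v := c)\<rparr>)"
  shows "memory (fold step ds s) = memory s \<and>
     (\<forall>i. i \<noteq> idx v \<longrightarrow> color_reg (fold step ds s) i = color_reg s i) \<and>
     real_reg (fold step ds s) 1 = real_reg s 1 +
       (\<Sum>c\<leftarrow>ds. weight (memory s) fs ((color_reg s \<circ> idx)(v := c)))"
proof (induction ds arbitrary: s)
  case (Cons d ds)
  have upd: "weight m fs (\<rho>(idx v := c) \<circ> idx) = weight m fs ((\<rho> \<circ> idx)(v := c))"
    for m \<rho> and c :: 'c
    using idx by (intro weight_cong) auto
  have 1: "memory (step d s) = memory s"
    "i \<noteq> idx v \<Longrightarrow> color_reg (step d s) i = color_reg s i"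
    "real_reg (step d s) 1 = real_reg s 1 + weight (memory s) fs ((color_reg s \<circ> idx)(v := d))" for i
    by (simp_all add: step_def run_multiply upd)
  \<comment> \<open>A round leaves its color in the register of \<open>v\<close>, where the next one
    overwrites it, so all summands can be read off the original state.\<close>
  have 2: "weight m fs ((color_reg (step d s) \<circ> idx)(v := c)) =
      weight m fs ((color_reg s \<circ> idx)(v := c))" for m and c :: 'c
    using idx by (intro weight_cong) (auto intro!: 1(2))
  have 3: "(\<forall>i. i \<noteq> idx v \<longrightarrow> r i = color_reg (step d s) i) \<longleftrightarrow>
      (\<forall>i. i \<noteq> idx v \<longrightarrow> r i = color_reg s i)" for r
    using 1(2) by auto
  have "memory (fold step ds (step d s)) = memory s \<and>
     (\<forall>i. i \<noteq> idx v \<longrightarrow> color_reg (fold step ds (step d s)) i = color_reg s i) \<and>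
     real_reg (fold step ds (step d s)) 1 =
       real_reg s 1 + (weight (memory s) fs ((color_reg s \<circ> idx)(v := d)) +
         (\<Sum>c\<leftarrow>ds. weight (memory s) fs ((color_reg s \<circ> idx)(v := c))))"
    using Cons[of "step d s"] unfolding 1(1,3) 2 3 add.assoc by blast
  then show ?case unfolding fold_simps list.map sum_list.Cons .
qed simp

lemma run_sum_out:
  assumes "\<forall>f\<in>set fs. \<forall>x\<in>set (snd f). idx x = idx v \<longrightarrow> x = v"
  shows "memory (run cs (sum_out idx v fs) s) = memory s"
    and "i \<noteq> idx v \<Longrightarrow> color_reg (run cs (sum_out idx v fs) s) i = color_reg s i"
    and "real_reg (run cs (sum_out idx v fs) s) 1 =
           (\<Sum>c\<leftarrow>cs. weight (memory s) fs ((color_reg s \<circ> idx)(v := c)))"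
  unfolding sum_out_def run_Seq run_For
  using fold_sum_out[of fs idx v cs cs "run cs (Zero 1) s", OF assms]
  by (auto simp: run_Seq[symmetric] comp_def)

text \<open>
  Stated for a nest inside outer loops over the registers \<open>js\<close>, so that the induction on \<open>is\<close> goes
  through.
\<close>

lemma run_loops:
  assumes body: "\<And>s. (\<forall>t'. t' \<noteq> t \<longrightarrow> memory s t' = m t') \<Longrightarrow>
      memory (run cs p s) = (memory s)(t := (memory s t)(map (color_reg s) (js @ is) :=
        f (map (color_reg s) (js @ is)))) \<and>
      (\<forall>i\<in>set (js @ is). color_reg (run cs p s) i = color_reg s i)"
    and "distinct (js @ is)"
    and "\<forall>t'. t' \<noteq> t \<longrightarrow> memory s t' = m t'"
  shows "(\<forall>i\<in>set js. color_reg (run cs (loops is p) s) i = color_reg s i) \<and>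
    memory (run cs (loops is p) s) = (memory s)(t := (\<lambda>a.
      if a \<in> (\<lambda>b. map (color_reg s) js @ b) ` {b. set b \<subseteq> set cs \<and> length b = length is}
      then f a else memory s t a))"
  using assms
proof (induction "is" arbitrary: js s)
  case Nil
  then show ?case by (auto simp: loops_def fun_eq_iff)
next
  case (Cons i "is")
  define A where "A \<rho> c = (\<lambda>b. map \<rho> js @ c # b) ` {b. set b \<subseteq> set cs \<and> length b = length is}"
    for \<rho> :: "nat \<Rightarrow> 'b" and c
  define step where
    "step = (\<lambda>c s. run cs (loops is p) (s\<lparr>color_reg := (color_reg s)(i := c)\<rparr>))"
  have i: "i \<notin> set js" using Cons.prems(2) by simp
  have step: "(\<forall>k\<in>set js. color_reg (step c s) k = color_reg s k) \<and>
      memory (step c s) = (memory s)(t := (\<lambda>a. if a \<in> A (color_reg s) c then f a else memory s t a))"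
    if "\<forall>t'. t' \<noteq> t \<longrightarrow> memory s t' = m t'" for c s
  proof -
    let ?s = "s\<lparr>color_reg := (color_reg s)(i := c)\<rparr>"
    have eq: "map (color_reg ?s) (js @ [i]) = map (color_reg s) js @ [c]" using i by auto
    have mem: "memory ?s = memory s" by simp
    \<comment> \<open>The inner nest runs inside loops over \<open>js @ [i]\<close>, so the color in
      register \<open>i\<close> joins the fixed prefix of the address.\<close>
    have "(\<forall>k\<in>set (js @ [i]). color_reg (run cs (loops is p) ?s) k = color_reg ?s k) \<and>
      memory (run cs (loops is p) ?s) = (memory ?s)(t := (\<lambda>a.
        if a \<in> (\<lambda>b. map (color_reg ?s) (js @ [i]) @ b) ` {b. set b \<subseteq> set cs \<and> length b = length is}
        then f a else memory ?s t a))"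
      by (rule Cons.IH) (use Cons.prems(1,2) that in simp_all)
    then show ?thesis using i unfolding eq mem by (auto simp: step_def A_def)
  qed
  have "(\<forall>k\<in>set js. color_reg (fold step ds s) k = color_reg s k) \<and>
      memory (fold step ds s) =
        (memory s)(t := (\<lambda>a. if \<exists>c\<in>set ds. a \<in> A (color_reg s) c then f a else memory s t a))"
    if "\<forall>t'. t' \<noteq> t \<longrightarrow> memory s t' = m t'" for ds s
    using that
  proof (induction ds arbitrary: s)
    case (Cons d ds)
    note st = step[OF Cons.prems, of d]
    \<comment> \<open>A round preserves the registers \<open>js\<close>, so the addresses written in
      later rounds can be computed in the initial state.\<close>
    have "map (color_reg (step d s)) js = map (color_reg s) js" using st by simp
    then have "A (color_reg (step d s)) = A (color_reg s)" unfolding A_def by (simp only:)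
    moreover have "\<forall>t'. t' \<noteq> t \<longrightarrow> memory (step d s) t' = m t'" using st Cons.prems by simp
    ultimately show ?case using Cons.IH[of "step d s"] st by (auto simp: fun_eq_iff)
  qed auto
  from this[OF Cons.prems(3), of cs]
  have *: "(\<forall>k\<in>set js. color_reg (run cs (loops (i # is) p) s) k = color_reg s k)"
    "memory (run cs (loops (i # is) p) s) =
        (memory s)(t := (\<lambda>a. if \<exists>c\<in>set cs. a \<in> A (color_reg s) c then f a else memory s t a))"
    by (simp_all add: loops_def run_For step_def)
  have "(\<exists>c\<in>set cs. a \<in> A (color_reg s) c) \<longleftrightarrow>
     a \<in> (\<lambda>b. map (color_reg s) js @ b) ` {b. set b \<subseteq> set cs \<and> length b = length (i # is)}" for a
    unfolding A_def by (force simp: length_Suc_conv image_iff)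
  then show ?case using * by simp
qed

text \<open>The order of this list is the index order of the new table. Without repetitions, it
  yields distinct loop registers and its length is the number of loops.\<close>

definition other_vars :: "'q \<Rightarrow> 'q factor list \<Rightarrow> 'q list" where
  "other_vars v fs = remdups (filter (\<lambda>x. x \<noteq> v) (concat (map snd fs)))"

lemma set_other_vars: "set (other_vars v fs) = (\<Union>f\<in>set fs. set (snd f)) - {v}"
  by (auto simp: other_vars_def)

definition tabulate :: "('q \<Rightarrow> nat) \<Rightarrow> 'q \<Rightarrow> 'q factor list \<Rightarrow> 'q table \<Rightarrow> 'q com" where
  "tabulate idx v fs t =
     loops (map idx (other_vars v fs))
       (Seq (sum_out idx v fs) (Store t (map idx (other_vars v fs)) 1))"

text \<open>The table \<open>t\<close> being filled is not among those read, so earlier stores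
  cannot affect later sums. Injectivity of \<open>idx\<close> gives different vertices different
  loop registers.\<close>

lemma run_tabulate:
  fixes cs :: "'c list" and fs :: "'q factor list" and v :: 'q
  assumes inj: "inj_on idx V" and v: "v \<in> V" and fs: "\<forall>f\<in>set fs. set (snd f) \<subseteq> V"
    and t: "t \<notin> fst ` set fs"
  defines "us \<equiv> other_vars v fs"
  shows "t' \<noteq> t \<Longrightarrow> memory (run cs (tabulate idx v fs t) s) t' = memory s t'"
    and "(\<And>x. x \<in> set us \<Longrightarrow> \<pi> x \<in> set cs) \<Longrightarrow>
      memory (run cs (tabulate idx v fs t) s) t (map \<pi> us) =
        (\<Sum>c\<leftarrow>cs. weight (memory s) fs (\<pi>(v := c)))"
proof -
  have us: "set us \<subseteq> V" using fs by (fastforce simp: us_def set_other_vars)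
  have "\<forall>f\<in>set fs. \<forall>x\<in>set (snd f). idx x = idx v \<longrightarrow> x = v"
    using fs v inj_onD[OF inj] by blast
  note run_sum = run_sum_out[OF this]
  define g where "g \<rho> = (\<Sum>c\<leftarrow>cs. weight (memory s) fs (\<rho>(v := c)))" for \<rho>
  \<comment> \<open>An entry must be a function of its address, so \<open>f\<close> decodes an
    address into an assignment. Its values outside \<open>us\<close> are immaterial: the factors
    mention only \<open>us\<close> and \<open>v\<close>, and \<open>v\<close> is
    overwritten.\<close>
  define f where "f a = g (\<lambda>x. the (map_of (zip us a) x))" for a
  have dist: "distinct (map idx us)"
    using inj_on_subset[OF inj us] by (auto simp: us_def other_vars_def distinct_map)
  have f: "f (map \<rho> us) = g \<rho>" for \<rho>
    unfolding f_def g_def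
    by (intro arg_cong[where f = sum_list] map_cong weight_cong)
      (auto simp: us_def map_of_zip_map other_vars_def)
  have body: "memory (run cs (Seq (sum_out idx v fs) (Store t (map idx us) 1)) s') =
        (memory s')(t := (memory s' t)(map (color_reg s') (map idx us) :=
          f (map (color_reg s') (map idx us)))) \<and>
      (\<forall>i\<in>set (map idx us).
        color_reg (run cs (Seq (sum_out idx v fs) (Store t (map idx us) 1)) s') i = color_reg s' i)"
    if s': "\<forall>t'. t' \<noteq> t \<longrightarrow> memory s' t' = memory s t'" for s'
  proof -
    \<comment> \<open>Summing over \<open>v\<close> writes to no color register that addresses the
      store.\<close>
    have "idx x \<noteq> idx v" if "x \<in> set us" for x
      using that inj_onD[OF inj _ _ v, of x] us by (auto simp: us_def set_other_vars)
    then have reg: "color_reg (run cs (sum_out idx v fs) s') (idx x) = color_reg s' (idx x)"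
      if "x \<in> set us" for x using run_sum(2) that by blast
    have "real_reg (run cs (sum_out idx v fs) s') 1 = g (color_reg s' \<circ> idx)"
      unfolding run_sum(3) g_def using s' t
      by (intro arg_cong[where f = sum_list] map_cong weight_cong) auto
    also have "\<dots> = f (map (color_reg s') (map idx us))" by (simp add: f[symmetric])
    finally show ?thesis
      using reg by (simp add: run_sum(1) comp_def cong: map_cong)
  qed
  have *: "memory (run cs (tabulate idx v fs t) s) = (memory s)(t := (\<lambda>a.
      if a \<in> {b. set b \<subseteq> set cs \<and> length b = length us} then f a else memory s t a))"
    using run_loops[where js = "[]" and m = "memory s" and t = t and f = f and s = s,
        OF _ _ , of cs "Seq (sum_out idx v fs) (Store t (map idx us) 1)" "map idx us"] body dist
    by (simp add: tabulate_def us_def)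
  show "t' \<noteq> t \<Longrightarrow> memory (run cs (tabulate idx v fs t) s) t' = memory s t'"
    unfolding * by simp
  show "memory (run cs (tabulate idx v fs t) s) t (map \<pi> us) =
      (\<Sum>c\<leftarrow>cs. weight (memory s) fs (\<pi>(v := c)))"
    if "\<And>x. x \<in> set us \<Longrightarrow> \<pi> x \<in> set cs"
    using that f[of \<pi>] unfolding * by (auto simp: g_def)
qed

abbreviation with_var :: "'q \<Rightarrow> 'q factor list \<Rightarrow> 'q factor list" where
  "with_var v fs \<equiv> filter (\<lambda>f. v \<in> set (snd f)) fs"

abbreviation without_var :: "'q \<Rightarrow> 'q factor list \<Rightarrow> 'q factor list" where
  "without_var v fs \<equiv> filter (\<lambda>f. v \<notin> set (snd f)) fs"

text \<open>\<open>k\<close> numbers the next work table. If the scopes mention only vertices of the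
  list, the factors left at the end are constants, and their product goes to the result register
  0.\<close>

primrec eliminate ::
    "('q \<Rightarrow> nat) \<Rightarrow> nat \<Rightarrow> 'q list \<Rightarrow> 'q factor list \<Rightarrow> 'q com" where
  "eliminate idx k [] fs = multiply idx 0 fs"
| "eliminate idx k (v # vs) fs =
     Seq (tabulate idx v (with_var v fs) (Work k))
         (eliminate idx (Suc k) vs
            ((Work k, other_vars v (with_var v fs)) # without_var v fs))"

lemma weight_split:
  "weight m fs \<pi> = weight m (with_var v fs) \<pi> * weight m (without_var v fs) \<pi>"
  by (induction fs) (auto simp: weight_def)

lemma sum_PiE_insert:
  fixes h :: "('a \<Rightarrow> 'b) \<Rightarrow> real"
  assumes "v \<notin> V"
  shows "(\<Sum>\<pi>\<in>insert v V \<rightarrow>\<^sub>E C. h \<pi>) = (\<Sum>\<pi>\<in>V \<rightarrow>\<^sub>E C. \<Sum>c\<in>C. h (\<pi>(v := c)))"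
proof -
  have "(\<Sum>\<pi>\<in>insert v V \<rightarrow>\<^sub>E C. h \<pi>) = (\<Sum>(c, \<pi>)\<in>C \<times> (V \<rightarrow>\<^sub>E C). h (\<pi>(v := c)))"
    unfolding PiE_insert_eq
    by (subst sum.reindex[OF inj_combinator[OF assms]]) (simp add: case_prod_unfold)
  also have "\<dots> = (\<Sum>\<pi>\<in>V \<rightarrow>\<^sub>E C. \<Sum>c\<in>C. h (\<pi>(v := c)))"
    by (simp add: sum.cartesian_product[symmetric] sum.swap[of _ C])
  finally show ?thesis .
qed

text \<open>The distributive law pulls the factors without \<open>v\<close> out of the sum over the
  color of \<open>v\<close>; the remaining sum is the entry of the new table. The bound on table
  numbers keeps \<open>Work k\<close> fresh, and \<open>V\<close> stays fixed while
  \<open>vs\<close> shrinks.\<close>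

lemma run_eliminate:
  assumes inj: "inj_on idx V" and cs: "distinct cs" and "set vs \<subseteq> V" "distinct vs"
    and "\<And>f. f \<in> set fs \<Longrightarrow> set (snd f) \<subseteq> set vs"
    and "\<And>f j. f \<in> set fs \<Longrightarrow> fst f = Work j \<Longrightarrow> j < k"
  shows "real_reg (run cs (eliminate idx k vs fs) s) 0 =
    (\<Sum>\<pi>\<in>set vs \<rightarrow>\<^sub>E set cs. weight (memory s) fs \<pi>)"
  using assms(3-)
proof (induction vs arbitrary: fs k s)
  case Nil
  \<comment> \<open>With all scopes empty the registers do not matter, and the sum has the single
    index \<open>\<lambda>_. undefined\<close>.\<close>
  then have "weight (memory s) fs (color_reg s \<circ> idx) = weight (memory s) fs (\<lambda>_. undefined)"
    by (intro weight_cong) auto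
  then show ?case by (simp add: run_multiply)
next
  case (Cons v vs)
  define fs1 fs2 us where "fs1 = with_var v fs" and "fs2 = without_var v fs"
    and "us = other_vars v fs1"
  define s' where "s' = run cs (tabulate idx v fs1 (Work k)) s"
  have fresh: "Work k \<notin> fst ` set fs"
    using Cons.prems(4) by fastforce
  then have fresh1: "Work k \<notin> fst ` set fs1" by (auto simp: fs1_def)
  have V: "v \<in> V" "\<forall>f\<in>set fs1. set (snd f) \<subseteq> V"
    using Cons.prems(1,3) unfolding fs1_def by (simp, fastforce)
  have us: "set us \<subseteq> set vs"
    using Cons.prems(3) by (fastforce simp: us_def set_other_vars fs1_def)
  have "real_reg (run cs (eliminate idx k (v # vs) fs) s) 0 =
      real_reg (run cs (eliminate idx (Suc k) vs ((Work k, us) # fs2)) s') 0"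
    by (simp add: s'_def us_def fs1_def fs2_def)
  also have "\<dots> = (\<Sum>\<pi>\<in>set vs \<rightarrow>\<^sub>E set cs. weight (memory s') ((Work k, us) # fs2) \<pi>)"
  proof (rule Cons.IH)
    show "set vs \<subseteq> V" "distinct vs" using Cons.prems(1,2) by simp_all
    show "set (snd f) \<subseteq> set vs" if "f \<in> set ((Work k, us) # fs2)" for f
      using that us Cons.prems(3)[of f] by (cases "f = (Work k, us)") (auto simp: fs2_def)
    show "j < Suc k" if "f \<in> set ((Work k, us) # fs2)" "fst f = Work j" for f j
      using that Cons.prems(4)[of f j] by (cases "f = (Work k, us)") (auto simp: fs2_def)
  qed
  also have "\<dots> = (\<Sum>\<pi>\<in>set vs \<rightarrow>\<^sub>E set cs. \<Sum>c\<in>set cs. weight (memory s) fs (\<pi>(v := c)))"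
  proof (rule sum.cong[OF refl])
    fix \<pi> assume \<pi>: "\<pi> \<in> set vs \<rightarrow>\<^sub>E set cs"
    have "weight (memory s') ((Work k, us) # fs2) \<pi> = memory s' (Work k) (map \<pi> us) *
        weight (memory s') fs2 \<pi>" by (simp add: weight_def)
    also have "memory s' (Work k) (map \<pi> us) = (\<Sum>c\<leftarrow>cs. weight (memory s) fs1 (\<pi>(v := c)))"
      unfolding s'_def us_def
      by (rule run_tabulate(2)[OF inj V fresh1]) (use \<pi> us in \<open>auto simp: us_def\<close>)
    also have "\<dots> = (\<Sum>c\<in>set cs. weight (memory s) fs1 (\<pi>(v := c)))"
      using cs by (simp add: sum_list_distinct_conv_sum_set)
    \<comment> \<open>The factors in \<open>fs2\<close> neither mention \<open>v\<close> nor use the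
      table \<open>Work k\<close>, so their weight is unchanged by setting the color of
      \<open>v\<close> and by the tabulation.\<close>
    also have "\<dots> * weight (memory s') fs2 \<pi> =
        (\<Sum>c\<in>set cs. weight (memory s) fs1 (\<pi>(v := c)) * weight (memory s) fs2 (\<pi>(v := c)))"
      unfolding sum_distrib_right
    proof (intro sum.cong refl arg_cong2[where f = "(*)"] weight_cong)
      fix f assume "f \<in> set fs2"
      then have "fst f \<noteq> Work k" using fresh by (force simp: fs2_def)
      then show "memory s' (fst f) = memory s (fst f)"
        unfolding s'_def by (rule run_tabulate(1)[OF inj V fresh1])
    qed (auto simp: fs2_def)
    finally show "weight (memory s') ((Work k, us) # fs2) \<pi> =
        (\<Sum>c\<in>set cs. weight (memory s) fs (\<pi>(v := c)))"
      by (simp add: weight_split[where fs = fs and v = v] fs1_def fs2_def)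
  qed
  also have "\<dots> = (\<Sum>\<pi>\<in>set (v # vs) \<rightarrow>\<^sub>E set cs. weight (memory s) fs \<pi>)"
    using Cons.prems(2) by (simp add: sum_PiE_insert)
  finally show ?case .
qed

section \<open>Running time of the elimination\<close>

lemma steps_multiply: "steps n (multiply idx r fs) = 1 + 2 * length fs"
  by (induction fs) auto

text \<open>At most \<open>w\<close> loops enumerate the entries and one more sums over
  \<open>v\<close>, which gives the exponent \<open>w + 1\<close>.\<close>

lemma steps_tabulate_le:
  assumes "1 \<le> n" "card (set (other_vars v fs)) \<le> w"
  shows "steps n (tabulate idx v fs t) \<le> (2 * length fs + 2 * w + 6) * n ^ Suc w"
proof -
  define l where "l = length (other_vars v fs)"
  have "distinct (other_vars v fs)" by (simp add: other_vars_def)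
  then have l: "l \<le> w" using assms(2) distinct_card by (metis l_def)
  \<comment> \<open>The 3 counts \<open>Zero\<close>, the initialisation of the loop and
    \<open>Store\<close>; a round takes \<open>1 + 2 * length fs\<close> steps for the product, one
    for \<open>Add\<close> and one for the iteration.\<close>
  have "steps n (Seq (sum_out idx v fs) (Store t (map idx (other_vars v fs)) 1)) =
      3 + n * (2 * length fs + 3)"
    by (simp add: sum_out_def steps_multiply algebra_simps)
  then have "steps n (tabulate idx v fs t) \<le> n ^ l * (3 + n * (2 * length fs + 3) + 2 * l)"
    using steps_loops_le[OF assms(1), of "map idx (other_vars v fs)"
        "Seq (sum_out idx v fs) (Store t (map idx (other_vars v fs)) 1)"]
    by (simp only: tabulate_def l_def length_map)
  \<comment> \<open>As \<open>1 \<le> n\<close>, the terms outside the inner loop may be multiplied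
    by \<open>n\<close> as well.\<close>
  also have "\<dots> \<le> n ^ l * (n * 3 + n * (2 * length fs + 3) + n * (2 * w))"
    using assms(1) l mult_le_mono[OF assms(1) l] by (intro mult_le_mono2 add_mono) auto
  also have "\<dots> = (2 * length fs + 2 * w + 6) * n ^ Suc l" by (simp add: algebra_simps)
  also have "\<dots> \<le> (2 * length fs + 2 * w + 6) * n ^ Suc w"
    using assms(1) l by (intro mult_left_mono power_increasing) auto
  finally show ?thesis .
qed

text \<open>\<open>eliminate\<close> transforms scopes as \<open>elim_width\<close> does, so each
  vertex costs at most a constant times \<open>n ^ Suc w\<close>. \<open>K\<close> collects these
  constants and is chosen before \<open>n\<close>.\<close>

lemma steps_eliminate_le:
  assumes "elim_width w vs ((\<lambda>f. set (snd f)) ` set fs)"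
  shows "\<exists>K. \<forall>n\<ge>1. steps n (eliminate idx k vs fs) \<le> K * n ^ Suc w"
  using assms
proof (induction vs arbitrary: fs k)
  case Nil
  have "steps n (eliminate idx k [] fs) \<le> (1 + 2 * length fs) * n ^ Suc w" if "1 \<le> n" for n
    using mult_le_mono2[of 1 "n ^ Suc w" "1 + 2 * length fs"] that
    by (simp add: steps_multiply one_le_power del: power_Suc)
  then show ?case by blast
next
  case (Cons v vs)
  define fs1 gs where "fs1 = with_var v fs"
    and "gs = (Work k, other_vars v fs1) # without_var v fs"
  have us: "\<Union>{X \<in> (\<lambda>f. set (snd f)) ` set fs. v \<in> X} - {v} = set (other_vars v fs1)"
    by (auto simp: set_other_vars fs1_def)
  \<comment> \<open>The scopes of the new factor list are exactly those that
    \<open>elim_width\<close> passes on.\<close>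
  have "insert (set (other_vars v fs1)) {X \<in> (\<lambda>f. set (snd f)) ` set fs. v \<notin> X} =
      (\<lambda>f. set (snd f)) ` set gs"
    by (auto simp: gs_def)
  with Cons.prems have "card (set (other_vars v fs1)) \<le> w"
    and "elim_width w vs ((\<lambda>f. set (snd f)) ` set gs)"
    by (simp_all only: elim_width.simps us)
  moreover from Cons.IH[OF this(2), of "Suc k"]
  obtain K where "\<And>n. 1 \<le> n \<Longrightarrow> steps n (eliminate idx (Suc k) vs gs) \<le> K * n ^ Suc w" by blast
  ultimately have "steps n (eliminate idx k (v # vs) fs) \<le>
      (2 * length fs1 + 2 * w + 6 + K) * n ^ Suc w" if "1 \<le> n" for n
    using add_mono[OF steps_tabulate_le[OF that, of v fs1 w idx "Work k"], of _ "K * n ^ Suc w"] that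
    by (simp only: eliminate.simps steps.simps fs1_def gs_def add_mult_distrib)
  then show ?case by blast
qed

section \<open>The lifted count as a sum of products of factors\<close>

definition query_factors :: "'q \<Rightarrow> ('q \<times> 'q) list \<Rightarrow> 'q factor list" where
  "query_factors x1 es = (Psi, [x1]) # map (\<lambda>e. (Omega e, [fst e, snd e])) es"

text \<open>\<open>decomposes\<close> determines \<open>W\<close> on homomorphisms only, so
  \<open>W\<close> is replaced by the weight there before the sum is extended to all maps; elsewhere
  the weight is zero.\<close>

lemma lifted_count_eq:
  assumes "pair_fin_digraph Q" "decomposes Q (color_graph G C \<sigma>) \<psi> W x1 \<omega>"
    and "input_loaded Q C \<psi> \<omega> s" "finite C" and es: "distinct es" "set es = parcs Q"
  shows "lifted_count Q (color_graph G C \<sigma>) W =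
    (\<Sum>\<pi>\<in>pverts Q \<rightarrow>\<^sub>E C. weight (memory s) (query_factors x1 es) \<pi>)"
proof -
  interpret pair_fin_digraph Q by fact
  let ?F = "color_graph G C \<sigma>"
  have x1: "x1 \<in> pverts Q" using assms(2) by (simp add: decomposes_def)
  have weight: "weight (memory s) (query_factors x1 es) \<pi> =
      real (\<psi> (\<pi> x1)) * (\<Prod>(x, y)\<in>parcs Q. \<omega> (x, y) (\<pi> x) (\<pi> y))"
    if "\<pi> \<in> pverts Q \<rightarrow>\<^sub>E C" for \<pi>
  proof -
    have \<pi>: "\<pi> x \<in> C" if "x \<in> pverts Q" for x using \<open>\<pi> \<in> _\<close> that by auto
    have "weight (memory s) (query_factors x1 es) \<pi> = memory s Psi [\<pi> x1] *
        (\<Prod>e\<in>parcs Q. memory s (Omega e) [\<pi> (fst e), \<pi> (snd e)])"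
      by (simp add: weight_def query_factors_def comp_def prod.distinct_set_conv_list[OF es(1)]
          flip: es(2))
    also have "memory s Psi [\<pi> x1] = real (\<psi> (\<pi> x1))"
      using assms(3) x1 \<pi> by (simp add: input_loaded_def)
    also have "(\<Prod>e\<in>parcs Q. memory s (Omega e) [\<pi> (fst e), \<pi> (snd e)]) =
        (\<Prod>(x, y)\<in>parcs Q. \<omega> (x, y) (\<pi> x) (\<pi> y))"
      using assms(3) \<pi> by (intro prod.cong)
        (auto simp: input_loaded_def dest: in_arcsD1 in_arcsD2)
    finally show ?thesis .
  qed
  have fin: "finite (pverts Q \<rightarrow>\<^sub>E C)"
    using pair_finite_verts assms(4) by (intro finite_PiE) auto
  have homs: "homs Q ?F = {\<pi> \<in> pverts Q \<rightarrow>\<^sub>E C. \<forall>(x, y)\<in>parcs Q. (\<pi> x, \<pi> y) \<in> parcs ?F}"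
    by (simp add: homs_def color_graph_def)
  have "lifted_count Q ?F W = (\<Sum>\<pi>\<in>homs Q ?F. weight (memory s) (query_factors x1 es) \<pi>)"
    unfolding lifted_count_def
  proof (rule sum.cong[OF refl])
    fix \<pi> assume "\<pi> \<in> homs Q ?F"
    then show "W \<pi> = weight (memory s) (query_factors x1 es) \<pi>"
      using assms(2) weight[of \<pi>] by (simp add: decomposes_def homs)
  qed
  also have "\<dots> = (\<Sum>\<pi>\<in>pverts Q \<rightarrow>\<^sub>E C. weight (memory s) (query_factors x1 es) \<pi>)"
  proof (rule sum.mono_neutral_left[OF fin])
    show "homs Q ?F \<subseteq> pverts Q \<rightarrow>\<^sub>E C" by (auto simp: homs)
    show "\<forall>\<pi>\<in>(pverts Q \<rightarrow>\<^sub>E C) - homs Q ?F. weight (memory s) (query_factors x1 es) \<pi> = 0"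
    proof
      fix \<pi> assume \<pi>: "\<pi> \<in> (pverts Q \<rightarrow>\<^sub>E C) - homs Q ?F"
      \<comment> \<open>Some arc is mapped to a non-arc, where its edge factor vanishes.\<close>
      then obtain x y where xy: "(x, y) \<in> parcs Q" "(\<pi> x, \<pi> y) \<notin> parcs ?F"
        by (auto simp: homs)
      then have "\<pi> x \<in> C" "\<pi> y \<in> C" using \<pi> by (auto dest: in_arcsD1 in_arcsD2)
      then have "\<omega> (x, y) (\<pi> x) (\<pi> y) = 0"
        using xy assms(2) by (auto simp: decomposes_def color_graph_def)
      then have "(\<Prod>(x, y)\<in>parcs Q. \<omega> (x, y) (\<pi> x) (\<pi> y)) = 0"
        using xy(1) pair_finite_arcs by (intro prod_zero bexI[of _ "(x, y)"]) auto
      then show "weight (memory s) (query_factors x1 es) \<pi> = 0" using weight \<pi> by simp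
    qed
  qed
  finally show ?thesis .
qed

text \<open>The program is built from \<open>Q\<close> and \<open>x1\<close> alone, along a
  decomposition of least width, so that it and \<open>K\<close> are fixed before the lifted graph is
  given.\<close>

lemma query_program:
  assumes "pair_fin_digraph Q" "x1 \<in> pverts Q"
  shows "\<exists>K. \<exists>p :: 'q com. \<forall>(G :: 'v pair_pre_digraph) (C :: 'c set) \<sigma> W \<omega> cs s.
      lifted_graph G C \<sigma> \<longrightarrow>
      decomposes Q (color_graph G C \<sigma>) (color_size G \<sigma>) W x1 \<omega> \<longrightarrow>
      distinct cs \<longrightarrow> set cs = C \<longrightarrow>
      input_loaded Q C (color_size G \<sigma>) \<omega> s \<longrightarrow>
      computes_within cs p s (lifted_count Q (color_graph G C \<sigma>) W)
        (K * card C ^ (treewidth Q + 1))"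
proof -
  interpret pair_fin_digraph Q by fact
  obtain T B where T: "tree_decomposition Q T B" and width: "decomposition_width T B = treewidth Q"
    using treewidth_attained[OF assms(1)] .
  obtain es where es: "set es = parcs Q" "distinct es"
    using finite_distinct_list[OF pair_finite_arcs] by blast
  obtain idx :: "'q \<Rightarrow> nat" where idx: "inj_on idx (pverts Q)"
    using finite_imp_inj_to_nat_seg[OF pair_finite_verts] by blast
  define fs where "fs = query_factors x1 es"
  define H where "H = (\<lambda>f. set (snd f)) ` set fs"
  have H: "H = insert {x1} ((\<lambda>(x, y). {x, y}) ` parcs Q)"
    by (auto simp: H_def fs_def query_factors_def image_image case_prod_unfold es)
  \<comment> \<open>The scope of \<open>x1\<close> is covered since every vertex lies in a bag, an
    edge scope since the ends of every arc share one.\<close>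
  have "\<exists>i\<in>pverts T. X \<subseteq> B i" if "X \<in> H" for X
    using that T assms(2) unfolding H tree_decomposition_def by fastforce
  then obtain vs where vs: "distinct vs" "set vs = pverts Q" "elim_width (treewidth Q) vs H"
    using decomposition_elim_order[OF T pair_finite_verts] width by metis
  define p where "p = eliminate idx 0 vs fs"
  obtain K where K: "\<And>n. 1 \<le> n \<Longrightarrow> steps n p \<le> K * n ^ (treewidth Q + 1)"
    using steps_eliminate_le[of "treewidth Q" vs fs idx 0] vs(3)
    unfolding p_def H_def Suc_eq_plus1 by blast
  have scopes: "set (snd f) \<subseteq> set vs" if "f \<in> set fs" for f
    using that assms(2)
    by (auto simp: fs_def query_factors_def vs es dest: in_arcsD1 in_arcsD2)
  \<comment> \<open>Work tables are numbered from 0: the input factors use none, so this holds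
    vacuously.\<close>
  have no_work: "j < 0" if "f \<in> set fs" "fst f = Work j" for f j
    using that by (auto simp: fs_def query_factors_def)
  have "computes_within cs p s (lifted_count Q (color_graph G C \<sigma>) W)
        (K * card C ^ (treewidth Q + 1))"
    if "lifted_graph G C \<sigma>" "decomposes Q (color_graph G C \<sigma>) (color_size G \<sigma>) W x1 \<omega>"
      "distinct cs" "set cs = C" "input_loaded Q C (color_size G \<sigma>) \<omega> s"
    for G :: "'v pair_pre_digraph" and C :: "'c set" and \<sigma> W \<omega> cs s
  proof -
    note colors = lifted_graph.finite_colors[OF that(1)] lifted_graph.colors_nonempty[OF that(1)]
    have len: "length cs = card C" using distinct_card[OF that(3)] that(4) by simp
    \<comment> \<open>The step bound is available for at least one color only, which
      \<open>C \<noteq> {}\<close> provides.\<close>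
    moreover have "1 \<le> card C"
      using colors by (simp add: Suc_le_eq card_gt_0_iff)
    ultimately have "snd (exec cs p s) \<le> K * card C ^ (treewidth Q + 1)"
      using K by (simp only: snd_exec)
    moreover have "real_reg (run cs p s) 0 =
        (\<Sum>\<pi>\<in>set vs \<rightarrow>\<^sub>E set cs. weight (memory s) fs \<pi>)"
      unfolding p_def
      by (rule run_eliminate[OF idx that(3) eq_refl[OF vs(2)] vs(1)])
        (erule scopes, erule (1) no_work)
    then have "real_reg (run cs p s) 0 = lifted_count Q (color_graph G C \<sigma>) W"
      by (simp only: lifted_count_eq[OF assms(1) that(2,5) colors(1) es(2,1)] vs(2) that(4) fs_def)
    ultimately show ?thesis by (simp add: computes_within_def case_prod_unfold)
  qed
  then show ?thesis by blast
qed

theorem theorem2: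
  fixes Q :: "'q pair_pre_digraph"
  assumes "pair_fin_digraph Q"
    and "Digraph_Component.connected (with_proj Q)"
  shows "\<exists>K::nat. \<forall>x1\<in>pverts Q. \<exists>p :: 'q com.
    \<forall>(G :: 'v pair_pre_digraph) (C :: 'c set) \<sigma> W \<omega> cs s.
      lifted_graph G C \<sigma> \<longrightarrow>
      decomposes Q (color_graph G C \<sigma>) (color_size G \<sigma>) W x1 \<omega> \<longrightarrow>
      distinct cs \<longrightarrow> set cs = C \<longrightarrow>
      input_loaded Q C (color_size G \<sigma>) \<omega> s \<longrightarrow>
      computes_within cs p s (lifted_count Q (color_graph G C \<sigma>) W)
        (K * card C ^ (treewidth Q + 1))"
proof -
  define computed where "computed x1 K p \<longleftrightarrow>
    (\<forall>(G :: 'v pair_pre_digraph) (C :: 'c set) \<sigma> W \<omega> cs s.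
      lifted_graph G C \<sigma> \<longrightarrow>
      decomposes Q (color_graph G C \<sigma>) (color_size G \<sigma>) W x1 \<omega> \<longrightarrow>
      distinct cs \<longrightarrow> set cs = C \<longrightarrow>
      input_loaded Q C (color_size G \<sigma>) \<omega> s \<longrightarrow>
      computes_within cs p s (lifted_count Q (color_graph G C \<sigma>) W)
        (K * card C ^ (treewidth Q + 1)))" for x1 K and p :: "'q com"
  have mono: "computed x1 K' p" if "computed x1 K p" "K \<le> K'" for x1 K K' p
    unfolding computed_def
  proof (intro allI impI)
    fix G :: "'v pair_pre_digraph" and C :: "'c set" and \<sigma> W \<omega> cs s
    assume "lifted_graph G C \<sigma>" "decomposes Q (color_graph G C \<sigma>) (color_size G \<sigma>) W x1 \<omega>"
      "distinct cs" "set cs = C" "input_loaded Q C (color_size G \<sigma>) \<omega> s"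
    then have "computes_within cs p s (lifted_count Q (color_graph G C \<sigma>) W)
        (K * card C ^ (treewidth Q + 1))"
      using that(1) unfolding computed_def by blast
    moreover have "K * card C ^ (treewidth Q + 1) \<le> K' * card C ^ (treewidth Q + 1)"
      using that(2) by (rule mult_le_mono1)
    ultimately show "computes_within cs p s (lifted_count Q (color_graph G C \<sigma>) W)
        (K' * card C ^ (treewidth Q + 1))"
      unfolding computes_within_def case_prod_unfold Let_def by (meson le_trans)
  qed
  have "\<forall>x1\<in>pverts Q. \<exists>K p. computed x1 K p"
    unfolding computed_def using query_program[OF assms(1)] by blast
  then obtain K p where Kp: "\<forall>x1\<in>pverts Q. computed x1 (K x1) (p x1)" by metis
  \<comment> \<open>The constant must not depend on \<open>x1\<close>; the sum of the constants over
    the finitely many query vertices serves for all of them.\<close>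
  have "K x1 \<le> (\<Sum>x\<in>pverts Q. K x)" if "x1 \<in> pverts Q" for x1
    using that assms(1) pair_fin_digraph.pair_finite_verts by (intro member_le_sum) auto
  then have "\<forall>x1\<in>pverts Q. \<exists>p. computed x1 (\<Sum>x\<in>pverts Q. K x) p"
    using Kp mono by blast
  then show ?thesis unfolding computed_def by (intro exI)
qed

end
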